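(* Let $m$ be an odd positive integer, $n$ a positive integer and $r$ an integer. Put $$P_k=\prod_{j=0}^{2m-1}w_{k+r+j},\qquad Q_k=\prod_{j=0}^{m-1}w_{k+r+j}\prod_{j=m+1}^{2m}w_{k+r+j}\qquad(k\ge1),$$ and assume $w_{k+r}\ne0$ for all $k\ge1$. Each identity below is asserted whenever both of its series converge and, writing its right-hand side as $v_m\sum_{k\ge1}Y_k/Q_k$, one has $\lim_{N\to\infty}Y_N/P_{N+1}=0$: $$\sum_{k=1}^{\infty} \frac{(k+n)\left[{k+n\atop k}\right]}{P_k} = v_m \sum_{k=1}^{\infty} \frac{\left[{k+n+1\atop k}\right]}{Q_k}$$ and $$\sum_{k=1}^{\infty} \frac{k\left\{{k+n\atop k}\right\}}{P_k} = v_m \sum_{k=1}^{\infty} \frac{\left\{{k+n+1\atop k}\right\}}{Q_k}.$$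
   Context: Let $a,b,p$ be complex numbers. The sequence $(w_n)$ is defined by $w_0=a$, $w_1=b$, $w_n=p\,w_{n-1}+w_{n-2}$, extended to negative indices by the same recurrence ($w_n=w_{n+2}-p\,w_{n+1}$). The companion sequence is $v_0=2$, $v_1=p$, $v_n=p\,v_{n-1}+v_{n-2}$ for $n\ge2$. $\left[{n\atop k}\right]$ are the unsigned Stirling numbers of the first kind and $\left\{{n\atop k}\right\}$ the Stirling numbers of the second kind, defined by $x(x+1)\cdots(x+n-1)=\sum_{k=0}^n\left[{n\atop k}\right]x^k$ and $x^n=\sum_{k=0}^n\left\{{n\atop k}\right\}x(x-1)\cdots(x-k+1)$. *)

theory Defs
  imports "HOL-Analysis.Analysis" "HOL-Combinatorics.Stirling"
begin

function horadam :: "complex \<Rightarrow> complex \<Rightarrow> complex \<Rightarrow> int \<Rightarrow> complex" where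
  "horadam a b p n =
     (if n = 0 then a else if n = 1 then b
      else if n \<ge> 2 then p * horadam a b p (n - 1) + horadam a b p (n - 2)
      else horadam a b p (n + 2) - p * horadam a b p (n + 1))"
  by pat_completeness auto
termination
  by (relation "Wellfounded.measure (\<lambda>(a, b, p, n). nat (if n \<ge> 0 then n else 1 - n))") auto

declare horadam.simps [simp del]

lemma horadam_0: "horadam a b p 0 = a"
  and horadam_1: "horadam a b p 1 = b"
  by (simp_all add: horadam.simps)

lemma horadam_rec: "horadam a b p n = p * horadam a b p (n - 1) + horadam a b p (n - 2)"
proof (cases "n \<ge> 2")
  case True
  then show ?thesis by (subst horadam.simps) auto
next
  case False
  then have "horadam a b p (n - 2) = horadam a b p n - p * horadam a b p (n - 1)"
    by (subst horadam.simps) auto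
  then show ?thesis by simp
qed

fun companion :: "complex \<Rightarrow> nat \<Rightarrow> complex" where
  "companion p 0 = 2"
| "companion p (Suc 0) = p"
| "companion p (Suc (Suc n)) = p * companion p (Suc n) + companion p n"

definition P_prod :: "complex \<Rightarrow> complex \<Rightarrow> complex \<Rightarrow> nat \<Rightarrow> int \<Rightarrow> nat \<Rightarrow> complex" where
  "P_prod a b p m r k = (\<Prod>j = 0..<2 * m. horadam a b p (int k + r + int j))"

definition Q_prod :: "complex \<Rightarrow> complex \<Rightarrow> complex \<Rightarrow> nat \<Rightarrow> int \<Rightarrow> nat \<Rightarrow> complex" where
  "Q_prod a b p m r k =
     (\<Prod>j = 0..<m. horadam a b p (int k + r + int j)) *
     (\<Prod>j = m + 1..2 * m. horadam a b p (int k + r + int j))"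

text \<open>
  The library constants \<^const>\<open>stirling\<close> (first kind, unsigned) and \<^const>\<open>Stirling\<close>
  (second kind) are given by recurrences; the next two facts are their defining expansions
  in rising and falling factorials.
\<close>

lemma stirling_rising:
  "(\<Prod>i<n. x + of_nat i) = (\<Sum>k\<le>n. of_nat (stirling n k) * (x :: complex) ^ k)"
  by (simp add: stirling_pochhammer pochhammer_prod atLeast0LessThan)

lemma Stirling_falling:
  "(x :: complex) ^ n = (\<Sum>k\<le>n. of_nat (Stirling n k) * (\<Prod>i<k. x - of_nat i))"
proof (induction n)
  case 0
  show ?case by simp
next
  case (Suc n)
  let ?f = "\<lambda>k. \<Prod>i<k. x - of_nat i"
  have step: "x * ?f k = ?f (Suc k) + of_nat k * ?f k" for k
    by (simp add: algebra_simps)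
  have shift: "(\<Sum>k\<le>n. of_nat (k * Stirling n k) * ?f k) =
      (\<Sum>k\<le>n. of_nat (Suc k * Stirling n (Suc k)) * ?f (Suc k))"
  proof -
    have "(\<Sum>k\<le>n. of_nat (k * Stirling n k) * ?f k) =
        (\<Sum>k\<le>Suc n. of_nat (k * Stirling n k) * ?f k)"
      by simp
    also have "\<dots> = (\<Sum>k\<le>n. of_nat (Suc k * Stirling n (Suc k)) * ?f (Suc k))"
      by (subst sum.atMost_Suc_shift) simp
    finally show ?thesis .
  qed
  have "x ^ Suc n = (\<Sum>k\<le>n. of_nat (Stirling n k) * (x * ?f k))"
    unfolding power_Suc Suc.IH sum_distrib_left by (simp add: mult_ac)
  also have "\<dots> = (\<Sum>k\<le>n. of_nat (Stirling n k) * ?f (Suc k)) +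
      (\<Sum>k\<le>n. of_nat (k * Stirling n k) * ?f k)"
    unfolding step by (simp add: sum.distrib distrib_left mult_ac del: prod.lessThan_Suc)
  also have "\<dots> = (\<Sum>k\<le>n. of_nat (Stirling (Suc n) (Suc k)) * ?f (Suc k))"
    unfolding shift sum.distrib[symmetric]
    by (intro sum.cong refl) (simp add: algebra_simps del: prod.lessThan_Suc)
  also have "\<dots> = (\<Sum>k\<le>Suc n. of_nat (Stirling (Suc n) k) * ?f k)"
    by (subst sum.atMost_Suc_shift) simp
  finally show ?case .
qed

end

theory Submission
  imports Defs
begin

text \<open>
  For odd \<open>m\<close> the Horadam sequence satisfies
  \<open>w\<^sub>t\<^sub>+\<^sub>2\<^sub>m - w\<^sub>t = v\<^sub>m w\<^sub>t\<^sub>+\<^sub>m\<close> (lemma \<open>horadam_double_shift\<close>).  The windows \<open>P\<^sub>k\<close> and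
  \<open>P\<^sub>k\<^sub>+\<^sub>1\<close> differ only in their end factors, and \<open>Q\<^sub>k\<close> is their union with the middle
  factor \<open>w\<^sub>k\<^sub>+\<^sub>r\<^sub>+\<^sub>m\<close> removed, so this identity says exactly that
  \<open>1 / P\<^sub>k - 1 / P\<^sub>k\<^sub>+\<^sub>1 = v\<^sub>m / Q\<^sub>k\<close> (lemma \<open>inverse_P_prod_diff\<close>).

  Both numerators on the left are differences \<open>Y\<^sub>k - Y\<^sub>k\<^sub>-\<^sub>1\<close> of the numerators on the right:
  this is the recurrence of the Stirling numbers along a diagonal, and \<open>Y\<^sub>0 = 0\<close>.  Summation
  by parts (lemma \<open>suminf_by_parts\<close>) then moves the difference from \<open>Y\<close> to \<open>1 / P\<close>; the
  boundary term \<open>Y\<^sub>N / P\<^sub>N\<^sub>+\<^sub>1\<close> is the one assumed to vanish in the limit.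
\<close>

text \<open>
  With \<open>w\<^sub>t = A \<alpha>\<^sup>t + B \<beta>\<^sup>t\<close>, \<open>\<alpha> \<beta> = -1\<close> and \<open>v\<^sub>m = \<alpha>\<^sup>m + \<beta>\<^sup>m\<close> this is
  \<open>v\<^sub>m \<alpha>\<^sup>t = \<alpha>\<^sup>t\<^sup>+\<^sup>m + (-1)\<^sup>m \<alpha>\<^sup>t\<^sup>-\<^sup>m\<close>.  Induction along the recurrence of the companion
  sequence also covers the case \<open>\<alpha> = \<beta>\<close>.
\<close>
lemma companion_mult_horadam:
  "companion p m * horadam a b p t =
     horadam a b p (t + int m) + (- 1) ^ m * horadam a b p (t - int m)"
proof (induction p m rule: companion.induct)
  case (1 p)
  show ?case by simp
next
  case (2 p)
  have "horadam a b p (t + 1) = p * horadam a b p t + horadam a b p (t - 1)"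
    using horadam_rec[of a b p "t + 1"] by simp
  then show ?case by simp
next
  case (3 p m)
  have up: "horadam a b p (t + int (Suc (Suc m))) =
      p * horadam a b p (t + int (Suc m)) + horadam a b p (t + int m)"
    using horadam_rec[of a b p "t + int (Suc (Suc m))"] by (simp add: algebra_simps)
  have down: "horadam a b p (t - int m) =
      p * horadam a b p (t - int (Suc m)) + horadam a b p (t - int (Suc (Suc m)))"
    using horadam_rec[of a b p "t - int m"] by (simp add: algebra_simps)
  have "companion p (Suc (Suc m)) * horadam a b p t =
      p * (companion p (Suc m) * horadam a b p t) + companion p m * horadam a b p t"
    by (simp add: algebra_simps)
  also have "\<dots> = horadam a b p (t + int (Suc (Suc m))) +
      (- 1) ^ Suc (Suc m) * horadam a b p (t - int (Suc (Suc m)))"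
    unfolding "3.IH" up down by (simp add: algebra_simps)
  finally show ?case .
qed

corollary horadam_double_shift:
  assumes "odd m"
  shows "horadam a b p (t + 2 * int m) - horadam a b p t =
     companion p m * horadam a b p (t + int m)"
  using companion_mult_horadam[of p m a b "t + int m"] assms by (simp add: algebra_simps)

lemma inverse_P_prod_diff:
  assumes "odd m" and nz: "\<And>i::nat. i \<ge> k \<Longrightarrow> horadam a b p (int i + r) \<noteq> 0"
  shows "1 / P_prod a b p m r k - 1 / P_prod a b p m r (Suc k) =
     companion p m / Q_prod a b p m r k"
proof -
  define w where "w j = horadam a b p (int k + r + int j)" for j
  \<comment> \<open>\<open>W\<close> is the common part of the windows \<open>P\<^sub>k\<close> and \<open>P\<^sub>k\<^sub>+\<^sub>1\<close>.\<close>
  define W where "W = (\<Prod>j = 1..<2 * m. w j)"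
  have w_nz: "w j \<noteq> 0" for j
    using nz[of "k + j"] by (simp add: w_def add_ac)
  have "m > 0" using \<open>odd m\<close> by (rule odd_pos)
  have P: "P_prod a b p m r k = w 0 * W"
    unfolding P_prod_def W_def w_def[symmetric]
    using \<open>m > 0\<close> by (subst prod.atLeast_Suc_lessThan) auto
  have "P_prod a b p m r (Suc k) = (\<Prod>j = 0..<2 * m. w (Suc j))"
    by (simp add: P_prod_def w_def add_ac)
  also have "\<dots> = (\<Prod>j = Suc 0..<Suc (2 * m). w j)"
    by (rule prod.shift_bounds_Suc_ivl[symmetric])
  also have "\<dots> = W * w (2 * m)"
    using \<open>m > 0\<close> by (simp add: W_def)
  finally have P': "P_prod a b p m r (Suc k) = W * w (2 * m)" .
  have Q: "Q_prod a b p m r k * w m = w 0 * W * w (2 * m)"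
  proof -
    have "(\<Prod>j = 0..<m. w j) * w m * (\<Prod>j = Suc m..<Suc (2 * m). w j) =
        (\<Prod>j = 0..<Suc (2 * m). w j)"
      by (subst prod.atLeast0_lessThan_Suc[symmetric], rule prod.atLeastLessThan_concat) auto
    also have "\<dots> = w 0 * W * w (2 * m)"
      using P by (simp add: P_prod_def w_def)
    finally show ?thesis
      by (simp add: Q_prod_def w_def[symmetric] atLeastLessThanSuc_atLeastAtMost mult_ac
               del: prod.op_ivl_Suc)
  qed
  have W_nz: "W \<noteq> 0" by (simp add: W_def w_nz)
  have shift: "w (2 * m) - w 0 = companion p m * w m"
    using horadam_double_shift[OF \<open>odd m\<close>, of a b p "int k + r"] by (simp add: w_def)
  have "1 / P_prod a b p m r k - 1 / P_prod a b p m r (Suc k) =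
      (w (2 * m) - w 0) / (w 0 * W * w (2 * m))"
    unfolding P P' using w_nz W_nz by (simp add: field_simps)
  also have "\<dots> = companion p m / Q_prod a b p m r k"
    unfolding shift Q[symmetric] using w_nz by simp
  finally show ?thesis .
qed

text \<open>
  The difference of the two series telescopes:
  \<open>(Y\<^sub>i\<^sub>+\<^sub>1 - Y\<^sub>i) / P\<^sub>i\<^sub>+\<^sub>1 - v Y\<^sub>i\<^sub>+\<^sub>1 / Q\<^sub>i\<^sub>+\<^sub>1 = Y\<^sub>i\<^sub>+\<^sub>1 / P\<^sub>i\<^sub>+\<^sub>2 - Y\<^sub>i / P\<^sub>i\<^sub>+\<^sub>1\<close>.
\<close>
lemma suminf_by_parts:
  fixes X Y P Q :: "nat \<Rightarrow> 'a::real_normed_field" and v :: 'a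
  assumes diff_Y: "\<And>i. X (Suc i) = Y (Suc i) - Y i" and "Y 0 = 0"
    and diff_P: "\<And>i. 1 / P (Suc i) - 1 / P (Suc (Suc i)) = v / Q (Suc i)"
    and summable_X: "summable (\<lambda>i. X (Suc i) / P (Suc i))"
    and summable_Y: "summable (\<lambda>i. Y (Suc i) / Q (Suc i))"
    and boundary: "(\<lambda>N. Y N / P (Suc N)) \<longlonglongrightarrow> 0"
  shows "(\<Sum>i. X (Suc i) / P (Suc i)) = v * (\<Sum>i. Y (Suc i) / Q (Suc i))"
proof -
  have "X (Suc i) / P (Suc i) - v * (Y (Suc i) / Q (Suc i)) =
      Y (Suc i) / P (Suc (Suc i)) - Y i / P (Suc i)" for i
  proof -
    have "v * (Y (Suc i) / Q (Suc i)) = Y (Suc i) * (1 / P (Suc i) - 1 / P (Suc (Suc i)))"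
      by (simp add: diff_P)
    then show ?thesis by (simp add: diff_Y diff_divide_distrib right_diff_distrib)
  qed
  then have "(\<lambda>i. X (Suc i) / P (Suc i) - v * (Y (Suc i) / Q (Suc i))) sums 0"
    using telescope_sums[OF boundary] \<open>Y 0 = 0\<close> by simp
  moreover have "(\<lambda>i. X (Suc i) / P (Suc i) - v * (Y (Suc i) / Q (Suc i))) sums
      ((\<Sum>i. X (Suc i) / P (Suc i)) - v * (\<Sum>i. Y (Suc i) / Q (Suc i)))"
    by (intro sums_diff sums_mult summable_sums summable_X summable_Y)
  ultimately show ?thesis
    by (auto dest: sums_unique2)
qed

theorem proposition7:
  fixes a b p :: complex and m n :: nat and r :: int
  assumes "odd m" and "n \<ge> 1"
    and "\<And>k::nat. k \<ge> 1 \<Longrightarrow> horadam a b p (int k + r) \<noteq> 0"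
  shows
    "(summable (\<lambda>i. let k = i + 1 in
          of_nat ((k + n) * stirling (k + n) k) / P_prod a b p m r k) \<and>
      summable (\<lambda>i. let k = i + 1 in
          of_nat (stirling (k + n + 1) k) / Q_prod a b p m r k) \<and>
      (\<lambda>N. of_nat (stirling (N + n + 1) N) / P_prod a b p m r (N + 1)) \<longlonglongrightarrow> 0
      \<longrightarrow>
      (\<Sum>i. let k = i + 1 in
          of_nat ((k + n) * stirling (k + n) k) / P_prod a b p m r k) =
      companion p m *
      (\<Sum>i. let k = i + 1 in
          of_nat (stirling (k + n + 1) k) / Q_prod a b p m r k))
     \<and>
     (summable (\<lambda>i. let k = i + 1 in
          of_nat (k * Stirling (k + n) k) / P_prod a b p m r k) \<and>
      summable (\<lambda>i. let k = i + 1 in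
          of_nat (Stirling (k + n + 1) k) / Q_prod a b p m r k) \<and>
      (\<lambda>N. of_nat (Stirling (N + n + 1) N) / P_prod a b p m r (N + 1)) \<longlonglongrightarrow> 0
      \<longrightarrow>
      (\<Sum>i. let k = i + 1 in
          of_nat (k * Stirling (k + n) k) / P_prod a b p m r k) =
      companion p m *
      (\<Sum>i. let k = i + 1 in
          of_nat (Stirling (k + n + 1) k) / Q_prod a b p m r k))"
proof -
  let ?P = "P_prod a b p m r" and ?Q = "Q_prod a b p m r"
  have diff_P: "1 / ?P (Suc i) - 1 / ?P (Suc (Suc i)) = companion p m / ?Q (Suc i)" for i
    using \<open>odd m\<close> assms(3) by (intro inverse_P_prod_diff) auto
  have first: "(of_nat ((Suc i + n) * stirling (Suc i + n) (Suc i)) :: complex) =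
      of_nat (stirling (Suc i + n + 1) (Suc i)) - of_nat (stirling (i + n + 1) i)" for i
    by simp
  have second: "(of_nat (Suc i * Stirling (Suc i + n) (Suc i)) :: complex) =
      of_nat (Stirling (Suc i + n + 1) (Suc i)) - of_nat (Stirling (i + n + 1) i)" for i
    by simp
  have "(\<Sum>i. of_nat ((Suc i + n) * stirling (Suc i + n) (Suc i)) / ?P (Suc i)) =
      companion p m * (\<Sum>i. of_nat (stirling (Suc i + n + 1) (Suc i)) / ?Q (Suc i))"
    if "summable (\<lambda>i. of_nat ((Suc i + n) * stirling (Suc i + n) (Suc i)) / ?P (Suc i))"
      and "summable (\<lambda>i. of_nat (stirling (Suc i + n + 1) (Suc i)) / ?Q (Suc i))"
      and "(\<lambda>N. of_nat (stirling (N + n + 1) N) / ?P (Suc N)) \<longlonglongrightarrow> 0"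
    by (rule suminf_by_parts[OF first _ diff_P that]) simp
  moreover have "(\<Sum>i. of_nat (Suc i * Stirling (Suc i + n) (Suc i)) / ?P (Suc i)) =
      companion p m * (\<Sum>i. of_nat (Stirling (Suc i + n + 1) (Suc i)) / ?Q (Suc i))"
    if "summable (\<lambda>i. of_nat (Suc i * Stirling (Suc i + n) (Suc i)) / ?P (Suc i))"
      and "summable (\<lambda>i. of_nat (Stirling (Suc i + n + 1) (Suc i)) / ?Q (Suc i))"
      and "(\<lambda>N. of_nat (Stirling (N + n + 1) N) / ?P (Suc N)) \<longlonglongrightarrow> 0"
    by (rule suminf_by_parts[OF second _ diff_P that]) simp
  ultimately show ?thesis
    unfolding Let_def Suc_eq_plus1 by blast
qed

end
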